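(* Let $0\le\alpha<1$ and $-1< B< A\leq 1$. The inclusion $\mathcal{S}^{*}[A,B]\subset \mathcal{BS}(\alpha)$ holds if either (i) $(1-\alpha)(1+6\alpha+\alpha^2)|B|(A-B)\leq 4\alpha (1-B^2)$ and $(1+\alpha)^2\left(4\alpha (A-B)^2 +B^2\right)\leq 4\alpha$, or (ii) $(1-\alpha)(1+6\alpha+\alpha^2)|B|(A-B)\geq 4\alpha (1-B^2)$ and $(1-\alpha)(A-B)+|B|\leq 1$.
   Context: $\mathbb{D}=\{z\in\mathbb{C}:|z|<1\}$. $\mathcal{A}$ is the class of analytic functions $f$ on $\mathbb{D}$ with $f(0)=0$, $f'(0)=1$. For analytic $p,q$ on $\mathbb{D}$, $p\prec q$ (subordination) means $p=q\circ w$ for some analytic $w:\mathbb{D}\to\mathbb{D}$ with $w(0)=0$. The expression $zf'(z)/f(z)$ takes the value $1$ at $z=0$; in conditions on it, it is understood to be analytic. For $0\le\alpha<1$, $G_\alpha(z)=1+\dfrac{z}{1-\alpha z^2}$ on $\mathbb{D}$, and $\mathcal{BS}(\alpha)$ is the class of $f\in\mathcal{A}$ with $zf'(z)/f(z)\prec G_\alpha(z)$. For $-1\le B<A\le1$, the Janowski class $\mathcal{S}^*[A,B]$ consists of the $f\in\mathcal{A}$ with $zf'(z)/f(z)\prec \dfrac{1+Az}{1+Bz}$. *)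

theory Defs
  imports "HOL-Complex_Analysis.Complex_Analysis"
begin

abbreviation unit_disc :: "complex set" ("\<D>") where
  "\<D> \<equiv> ball 0 1"

definition class_A :: "(complex \<Rightarrow> complex) set" ("\<A>") where
  "\<A> = {f. f holomorphic_on \<D> \<and> f 0 = 0 \<and> deriv f 0 = 1}"

definition subordinate :: "(complex \<Rightarrow> complex) \<Rightarrow> (complex \<Rightarrow> complex) \<Rightarrow> bool"
    (infix "\<prec>\<^sub>s" 50) where
  "p \<prec>\<^sub>s q \<longleftrightarrow> p holomorphic_on \<D> \<and> q holomorphic_on \<D> \<and>
     (\<exists>w. w holomorphic_on \<D> \<and> w ` \<D> \<subseteq> \<D> \<and> w 0 = 0 \<and> (\<forall>z\<in>\<D>. p z = q (w z)))"

(* The quotient z f'(z) / f(z) for f in class_A, with its limit 1 filled in at the origin.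
   At a zero of f in the disc other than the origin the quotient has a pole, and the
   convention x / 0 = 0 does not remove it: holomorphy of log_quot f on the disc, which
   subordination demands, therefore implies that f has no such zero. *)
definition log_quot :: "(complex \<Rightarrow> complex) \<Rightarrow> complex \<Rightarrow> complex" where
  "log_quot f z = (if z = 0 then 1 else z * deriv f z / f z)"

definition G_booth :: "real \<Rightarrow> complex \<Rightarrow> complex" where
  "G_booth \<alpha> z = 1 + z / (1 - of_real \<alpha> * z ^ 2)"

definition BS :: "real \<Rightarrow> (complex \<Rightarrow> complex) set" where
  "BS \<alpha> = {f \<in> \<A>. log_quot f \<prec>\<^sub>s G_booth \<alpha>}"

definition janowski_class :: "real \<Rightarrow> real \<Rightarrow> (complex \<Rightarrow> complex) set" where
  "janowski_class A B =
     {f \<in> \<A>. log_quot f \<prec>\<^sub>s (\<lambda>z. (1 + of_real A * z) / (1 + of_real B * z))}"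

end

theory Submission
  imports Defs
begin

text \<open>
  Put \<open>c = A - B\<close> and \<open>v = c z / (1 + B z)\<close>. One has to solve \<open>v = w / (1 - \<alpha> w\<^sup>2)\<close> with
  \<open>\<bar>w\<bar> < 1\<close>. In the reciprocal coordinate \<open>1/v = 1/w - \<alpha> w\<close> the unit circle goes to the
  ellipse with semi-axes \<open>1 - \<alpha>\<close> and \<open>1 + \<alpha>\<close>, while \<open>1/z = c/v - B\<close>. So the inclusion amounts to
  the ellipse, scaled by \<open>c\<close> and shifted by \<open>-B\<close>, lying in the closed unit disc. With \<open>t\<close> the
  cosine of the parameter this is a quadratic inequality on \<open>[-1, 1]\<close>: condition (i) is the case
  of an interior maximum, condition (ii) that of a maximum at an end point.
\<close>

section \<open>The quadratic inequality in the cosine parameter\<close>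

lemma ellipse_bound_vertex:
  fixes \<alpha> c B t :: real
  assumes "0 < \<alpha>" and "(1 + \<alpha>)^2 * (4 * \<alpha> * c^2 + B^2) \<le> 4 * \<alpha>"
  shows "B^2 + c^2 * (1 + \<alpha>)^2 - 2 * B * c * (1 - \<alpha>) * t - 4 * \<alpha> * c^2 * t^2 \<le> 1"
proof -
  let ?L = "B^2 + c^2 * (1 + \<alpha>)^2 - 2 * B * c * (1 - \<alpha>) * t - 4 * \<alpha> * c^2 * t^2"
  \<comment> \<open>Completing the square: the first term on the right is the vertex value times 4
    \<alpha>.\<close>
  have "4 * \<alpha> * ?L = (1 + \<alpha>)^2 * (4 * \<alpha> * c^2 + B^2) - (4 * \<alpha> * c * t + B * (1 - \<alpha>))^2"
    by (simp add: power2_eq_square algebra_simps)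
  also have "\<dots> \<le> 4 * \<alpha> * 1"
    using assms(2) zero_le_power2[of "4 * \<alpha> * c * t + B * (1 - \<alpha>)"] by linarith
  finally show ?thesis
    by (rule mult_left_le_imp_le) (use assms(1) in simp)
qed

text \<open>In b = |B| and s = |t|, with the worse sign of the linear term, the quadratic increases
  on [0, 1] by \<open>mono\<close>. Its value at s = 1 is ((1 - \<alpha>) c + b)^2.\<close>

lemma ellipse_bound_endpoint:
  fixes \<alpha> c B t :: real
  assumes "0 \<le> \<alpha>" and "\<alpha> < 1" and "0 < c" and "\<bar>B\<bar> < 1" and "\<bar>t\<bar> \<le> 1"
    and big: "4 * \<alpha> * (1 - B^2) \<le> (1 - \<alpha>) * (1 + 6 * \<alpha> + \<alpha>^2) * \<bar>B\<bar> * c"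
    and lin: "(1 - \<alpha>) * c + \<bar>B\<bar> \<le> 1"
  shows "B^2 + c^2 * (1 + \<alpha>)^2 - 2 * B * c * (1 - \<alpha>) * t - 4 * \<alpha> * c^2 * t^2 \<le> 1"
proof -
  define b s where "b = \<bar>B\<bar>" and "s = \<bar>t\<bar>"
  have b: "0 \<le> b" "b < 1" and s: "0 \<le> s" "s \<le> 1" and sq: "B^2 = b^2" "t^2 = s^2"
    using assms by (auto simp: b_def s_def)
  have cb: "(1 - \<alpha>) * c \<le> 1 - b"
    using lin by (simp add: b_def)
  \<comment> \<open>Bounding (1 - \<alpha>) c by 1 - b removes c from \<open>big\<close>; cancelling
    1 - b leaves a condition on \<alpha> and b alone.\<close>
  have "(1 - b) * (4 * \<alpha> * (1 + b)) = 4 * \<alpha> * (1 - B^2)"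
    unfolding sq by (simp add: power2_eq_square algebra_simps)
  also have "\<dots> \<le> ((1 + 6 * \<alpha> + \<alpha>^2) * b) * ((1 - \<alpha>) * c)"
    using big by (simp add: b_def mult_ac)
  also have "\<dots> \<le> ((1 + 6 * \<alpha> + \<alpha>^2) * b) * (1 - b)"
    using assms(1) b cb by (intro mult_left_mono) auto
  finally have "(1 - b) * (4 * \<alpha> * (1 + b)) \<le> (1 - b) * ((1 + 6 * \<alpha> + \<alpha>^2) * b)"
    by (simp add: mult_ac)
  then have "4 * \<alpha> * (1 + b) \<le> (1 + 6 * \<alpha> + \<alpha>^2) * b"
    using b by simp
  then have "4 * \<alpha> * (1 - b) \<le> b * (1 - \<alpha>)^2"
    by (simp add: power2_eq_square algebra_simps)
  moreover have "4 * \<alpha> * ((1 - \<alpha>) * c) \<le> 4 * \<alpha> * (1 - b)"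
    using assms(1) cb by (intro mult_left_mono) auto
  ultimately have "(1 - \<alpha>) * (4 * \<alpha> * c) \<le> (1 - \<alpha>) * (b * (1 - \<alpha>))"
    by (simp add: power2_eq_square mult_ac)
  then have mono: "4 * \<alpha> * c \<le> b * (1 - \<alpha>)"
    using assms(2) by simp
  have "2 * \<alpha> * c * (1 + s) \<le> 2 * \<alpha> * c * 2"
    using assms s by (intro mult_left_mono) auto
  with mono have "2 * \<alpha> * c * (1 + s) \<le> b * (1 - \<alpha>)"
    by simp
  \<comment> \<open>The value at s = 1 minus the value at s, in factored form.\<close>
  then have "0 \<le> 2 * c * (1 - s) * (b * (1 - \<alpha>) - 2 * \<alpha> * c * (1 + s))"
    using assms s by simp
  also have "\<dots> = ((1 - \<alpha>) * c + b)^2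
      - (b^2 + c^2 * (1 + \<alpha>)^2 + 2 * b * c * (1 - \<alpha>) * s - 4 * \<alpha> * c^2 * s^2)"
    by (simp add: power2_eq_square algebra_simps)
  finally have "b^2 + c^2 * (1 + \<alpha>)^2 + 2 * b * c * (1 - \<alpha>) * s - 4 * \<alpha> * c^2 * s^2
      \<le> ((1 - \<alpha>) * c + b)^2"
    by simp
  also have "\<dots> \<le> 1"
    using lin b assms by (intro power_le_one) (auto simp: b_def)
  finally have bound: "b^2 + c^2 * (1 + \<alpha>)^2 + 2 * b * c * (1 - \<alpha>) * s - 4 * \<alpha> * c^2 * s^2 \<le> 1" .
  have "- (B * t) \<le> b * s"
    by (metis abs_ge_minus_self abs_mult b_def s_def)
  then have "2 * c * (1 - \<alpha>) * (- (B * t)) \<le> 2 * c * (1 - \<alpha>) * (b * s)"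
    using assms by (intro mult_left_mono) auto
  then show ?thesis
    using bound by (simp add: sq mult_ac)
qed

text \<open>Both cases of the theorem enter only through \<open>ellipse\<close>: for |w| = 1 and t =
  Re w, its left side is |c (1/w - \<alpha> w) - B|^2.\<close>

locale ellipse_in_disc =
  fixes \<alpha> c B :: real
  assumes alpha: "0 \<le> \<alpha>" "\<alpha> < 1" and c_pos: "0 < c" and B_less: "\<bar>B\<bar> < 1"
    and ellipse: "\<And>t. \<bar>t\<bar> \<le> 1 \<Longrightarrow>
      B^2 + c^2 * (1 + \<alpha>)^2 - 2 * B * c * (1 - \<alpha>) * t - 4 * \<alpha> * c^2 * t^2 \<le> 1"
begin

section \<open>The Janowski function minus 1 and its preimage under the Booth map\<close>

definition v :: "complex \<Rightarrow> complex" where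
  "v z = of_real c * z / (1 + of_real B * z)"

text \<open>The root of \<open>\<alpha> v w\<^sup>2 + w - v = 0\<close> that vanishes with \<open>v\<close>, in a form without division by \<open>v\<close>.\<close>
definition W :: "complex \<Rightarrow> complex" where
  "W z = 2 * v z / (1 + csqrt (1 + 4 * of_real \<alpha> * (v z)^2))"

lemma denom_nonzero: "1 + of_real B * z \<noteq> 0" if "norm z < 1" for z :: complex
proof
  assume "1 + of_real B * z = 0"
  then have "of_real B * z = - 1"
    by (simp add: add_eq_0_iff)
  then have "norm (of_real B * z) = 1"
    by simp
  moreover have "\<bar>B\<bar> * norm z \<le> \<bar>B\<bar>"
    using that by (intro mult_left_le) auto
  ultimately show False
    using B_less by (simp add: norm_mult)
qed

lemma v_recover: "z * (of_real c - of_real B * v z) = v z" if "norm z < 1"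
proof -
  have "v z * (1 + of_real B * z) = of_real c * z"
    using denom_nonzero[OF that] by (simp add: v_def)
  then show ?thesis
    by (simp add: algebra_simps)
qed

lemma v_eq_0_iff: "v z = 0 \<longleftrightarrow> z = 0" if "norm z < 1"
  using denom_nonzero[OF that] c_pos by (simp add: v_def)

lemma v_holomorphic: "v holomorphic_on \<D>"
  unfolding v_def using denom_nonzero by (intro holomorphic_intros) auto

text \<open>Since z = v / (c - B v), the condition |z| < 1 becomes an inequality in v alone, the
  form that can be compared with the ellipse.\<close>

lemma norm_v_less: "norm (v z) < norm (of_real c - of_real B * v z)"
  if z: "norm z < 1" "z \<noteq> 0"
proof -
  have "of_real c - of_real B * v z \<noteq> 0"
    by (metis v_recover[OF z(1)] v_eq_0_iff[OF z(1)] z(2) mult_zero_right)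
  then have "norm z * norm (of_real c - of_real B * v z) < 1 * norm (of_real c - of_real B * v z)"
    using z by (intro mult_strict_right_mono) auto
  then show ?thesis
    by (simp only: norm_mult[symmetric] v_recover[OF z(1)] mult_1)
qed

text \<open>This keeps the principal root holomorphic. On the cut, v = i y with 4 \<alpha> y^2 \<ge>
  1, and \<open>norm_v_less\<close> then contradicts the ellipse bound at t = 0.\<close>

lemma radicand: "1 + 4 * of_real \<alpha> * (v z)^2 \<notin> \<real>\<^sub>\<le>\<^sub>0" if z: "norm z < 1"
proof
  let ?x = "Re (v z)" and ?y = "Im (v z)"
  assume "1 + 4 * of_real \<alpha> * (v z)^2 \<in> \<real>\<^sub>\<le>\<^sub>0"
  then have re: "1 + 4 * \<alpha> * (?x^2 - ?y^2) \<le> 0" and im: "\<alpha> * ?x * ?y = 0"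
    by (auto simp: complex_nonpos_Reals_iff power2_eq_square algebra_simps)
  have "\<alpha> * ?y^2 \<noteq> 0"
  proof
    assume y0: "\<alpha> * ?y^2 = 0"
    have "1 + 4 * (\<alpha> * ?x^2) - 4 * (\<alpha> * ?y^2) \<le> 0"
      using re by (simp add: algebra_simps)
    moreover have "0 \<le> \<alpha> * ?x^2"
      using alpha by simp
    ultimately show False
      using y0 by linarith
  qed
  with im have x0: "?x = 0" by auto
  have "z \<noteq> 0"
    using \<open>\<alpha> * ?y^2 \<noteq> 0\<close> v_eq_0_iff[OF z] by auto
  from norm_v_less[OF z this] have "(norm (v z))^2 < (norm (of_real c - of_real B * v z))^2"
    by (intro power_strict_mono) auto
  then have lt: "?y^2 < c^2 + B^2 * ?y^2"
    by (simp add: cmod_power2 x0 power_mult_distrib)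
  have "c^2 * 1 \<le> c^2 * (4 * \<alpha> * ?y^2)"
    using re x0 by (intro mult_left_mono) auto
  also have "\<dots> = c^2 * (4 * \<alpha>) * ?y^2" by simp
  \<comment> \<open>Here 4 \<alpha> \<le> (1 + \<alpha>)^2, as (1 - \<alpha>)^2 \<ge> 0.\<close>
  also have "\<dots> \<le> c^2 * (1 + \<alpha>)^2 * ?y^2"
    using zero_le_power2[of "1 - \<alpha>"]
    by (intro mult_right_mono mult_left_mono) (auto simp: power2_eq_square algebra_simps)
  finally have "?y^2 < (c^2 * (1 + \<alpha>)^2 + B^2) * ?y^2"
    using lt by (simp add: algebra_simps)
  moreover have "(c^2 * (1 + \<alpha>)^2 + B^2) * ?y^2 \<le> 1 * ?y^2"
    using ellipse[of 0] by (intro mult_right_mono) auto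
  ultimately show False by simp
qed

text \<open>The principal root has nonnegative real part, so the sum has real part at least
  1.\<close>

lemma W_denom: "1 + csqrt (1 + 4 * of_real \<alpha> * (v z)^2) \<noteq> 0"
proof
  assume "1 + csqrt (1 + 4 * of_real \<alpha> * (v z)^2) = 0"
  then have "1 + Re (csqrt (1 + 4 * of_real \<alpha> * (v z)^2)) = 0"
    by (metis Re_complex_of_real one_complex.simps(1) plus_complex.simps(1) of_real_0)
  moreover have "0 \<le> Re (csqrt (1 + 4 * of_real \<alpha> * (v z)^2))"
    by (rule Re_csqrt)
  ultimately show False by linarith
qed

lemma W_holomorphic: "W holomorphic_on \<D>"
  unfolding W_def using radicand W_denom
  by (intro holomorphic_intros v_holomorphic) auto

lemma W_eqn: "W z = v z * (1 - of_real \<alpha> * (W z)^2)"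
proof -
  define S where "S = csqrt (1 + 4 * of_real \<alpha> * (v z)^2)"
  have S2: "S^2 = 1 + 4 * of_real \<alpha> * (v z)^2"
    by (simp add: S_def)
  have nz: "1 + S \<noteq> 0"
    using W_denom by (simp add: S_def)
  have W: "W z * (1 + S) = 2 * v z"
    using nz by (simp add: W_def S_def)
  \<comment> \<open>The factor (1 + S)^2 clears the denominator of \<open>W\<close>;
    \<open>S2\<close> then cancels the terms in \<alpha>.\<close>
  have "(1 + S)^2 * (v z * (1 - of_real \<alpha> * (W z)^2))
      = v z * ((1 + S)^2 - of_real \<alpha> * (W z * (1 + S))^2)"
    by (simp add: power2_eq_square algebra_simps)
  also have "\<dots> = v z * (1 + 2 * S + S^2 - of_real \<alpha> * (2 * v z)^2)"
    by (simp only: W) (simp add: power2_eq_square algebra_simps)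
  also have "\<dots> = 2 * v z * (1 + S)"
    unfolding S2 by (simp add: power2_eq_square algebra_simps)
  also have "\<dots> = (1 + S)^2 * W z"
    by (simp add: W[symmetric] power2_eq_square)
  finally show ?thesis
    using nz by simp
qed

text \<open>If this vanished, \<open>W_eqn\<close> would give W z = 0, and the expression would be
  1.\<close>

lemma W_denom_booth: "1 - of_real \<alpha> * (W z)^2 \<noteq> 0"
  using W_eqn[of z] by auto

lemma v_eq_booth: "v z = W z / (1 - of_real \<alpha> * (W z)^2)"
  using W_eqn[of z] W_denom_booth[of z] by (simp add: field_simps)

section \<open>The values of \<open>W\<close> stay in the disc\<close>

lemma W_0: "W 0 = 0"
  by (simp add: W_def v_def)

text \<open>For |w| = 1, (c - B v) / v is a point of the scaled and shifted ellipse: its modulus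
  exceeds 1 by \<open>norm_v_less\<close> but is at most 1 by \<open>ellipse\<close>.\<close>

lemma norm_W_neq_1: "norm (W z) \<noteq> 1" if z: "norm z < 1"
proof
  assume W1: "norm (W z) = 1"
  define w where "w = W z"
  have w: "(Re w)^2 + (Im w)^2 = 1" "w \<noteq> 0"
    using W1 by (auto simp: w_def cmod_power2[symmetric])
  have inv: "w * cnj w = 1"
    using w(1) by (simp add: complex_mult_cnj)
  let ?d = "1 - of_real \<alpha> * w^2"
  have d: "?d \<noteq> 0" "v z = w / ?d"
    using W_denom_booth v_eq_booth by (simp_all add: w_def)
  have "z \<noteq> 0" using W_0 W1 by auto
  from norm_v_less[OF z this] d
  have "norm (w / ?d) < norm ((of_real c * ?d - of_real B * w) / ?d)"
    by (simp add: diff_divide_distrib)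
  then have "1 < norm (of_real c * ?d - of_real B * w)"
    using d W1 by (simp add: norm_divide divide_less_cancel w_def)
  \<comment> \<open>Replacing 1 by w times its conjugate pulls out the unimodular factor w.\<close>
  also have "of_real c * ?d - of_real B * w
      = w * (of_real c * (cnj w - of_real \<alpha> * w) - of_real B)"
    using inv by (simp add: power2_eq_square algebra_simps)
  finally have "1 < norm (of_real c * (cnj w - of_real \<alpha> * w) - of_real B)"
    using W1 by (simp add: norm_mult w_def)
  then have "1 < (norm (of_real c * (cnj w - of_real \<alpha> * w) - of_real B))^2"
    by (simp add: one_less_power)
  also have "\<dots> = (c * (1 - \<alpha>) * Re w - B)^2 + (c * (1 + \<alpha>))^2 * (Im w)^2"
    unfolding cmod_power2 by (simp add: power2_eq_square algebra_simps)
  also have "(Im w)^2 = 1 - (Re w)^2"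
    using w by simp
  also have "(c * (1 - \<alpha>) * Re w - B)^2 + (c * (1 + \<alpha>))^2 * (1 - (Re w)^2)
      = B^2 + c^2 * (1 + \<alpha>)^2 - 2 * B * c * (1 - \<alpha>) * Re w - 4 * \<alpha> * c^2 * (Re w)^2"
    by (simp add: power2_eq_square algebra_simps)
  also have "\<dots> \<le> 1"
    using W1 abs_Re_le_cmod[of w] by (intro ellipse) (simp add: w_def)
  finally show False by simp
qed

text \<open>\<open>W\<close> fixes 0 and avoids the unit circle, so by connectedness it cannot leave the disc.\<close>
lemma norm_W_less_1: "norm (W z) < 1" if z: "norm z < 1"
proof (rule ccontr)
  assume "\<not> norm (W z) < 1"
  then have "1 \<le> norm (W z)"
    by simp
  have "continuous_on \<D> (\<lambda>z. norm (W z))"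
    by (rule continuous_on_norm[OF holomorphic_on_imp_continuous_on[OF W_holomorphic]])
  then have "connected ((\<lambda>z. norm (W z)) ` \<D>)"
    by (rule connected_continuous_image) (rule connected_ball)
  moreover have "norm (W 0) \<in> (\<lambda>z. norm (W z)) ` \<D>"
    by (rule imageI) simp
  moreover have "norm (W z) \<in> (\<lambda>z. norm (W z)) ` \<D>"
    by (rule imageI) (simp add: z)
  ultimately have "1 \<in> (\<lambda>z. norm (W z)) ` \<D>"
    by (rule connectedD_interval) (simp add: W_0, fact)
  then obtain u where "u \<in> \<D>" "norm (W u) = 1"
    by (metis imageE)
  then show False
    using norm_W_neq_1[of u] by simp
qed

section \<open>Transfer to subordination\<close>

lemma janowski_eq_booth:
  assumes "norm z < 1"
  shows "(1 + of_real (c + B) * z) / (1 + of_real B * z) = G_booth \<alpha> (W z)"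
proof -
  have "G_booth \<alpha> (W z) = 1 + v z"
    by (simp add: G_booth_def v_eq_booth[symmetric])
  also have "\<dots> = (1 + of_real B * z + of_real c * z) / (1 + of_real B * z)"
    using denom_nonzero[OF assms] by (simp add: v_def add_divide_distrib)
  also have "\<dots> = (1 + of_real (c + B) * z) / (1 + of_real B * z)"
    by (simp add: algebra_simps)
  finally show ?thesis
    by (rule sym)
qed

text \<open>If w is the Schwarz function of the Janowski subordination, \<open>W \<circ> w\<close>
  is one for the Booth map.\<close>

lemma janowski_class_subset_BS: "janowski_class (c + B) B \<subseteq> BS \<alpha>"
proof
  fix f assume "f \<in> janowski_class (c + B) B"
  then obtain w where f: "f \<in> \<A>" and hol: "log_quot f holomorphic_on \<D>"
    and w: "w holomorphic_on \<D>" "w ` \<D> \<subseteq> \<D>" "w 0 = 0"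
    and eq: "\<And>z. z \<in> \<D> \<Longrightarrow>
      log_quot f z = (1 + of_real (c + B) * w z) / (1 + of_real B * w z)"
    unfolding janowski_class_def subordinate_def by blast
  have "1 - of_real \<alpha> * z^2 \<noteq> (0::complex)" if "norm z < 1" for z
  proof
    assume "1 - of_real \<alpha> * z^2 = (0::complex)"
    then have "norm (of_real \<alpha> * z^2) = 1"
      by simp
    moreover have "\<alpha> * (norm z)^2 \<le> \<alpha>"
      using that alpha by (intro mult_left_le) (auto intro: power_le_one)
    ultimately show False
      using alpha by (simp add: norm_mult norm_power)
  qed
  then have G: "G_booth \<alpha> holomorphic_on \<D>"
    unfolding G_booth_def by (intro holomorphic_intros) auto
  have "(W \<circ> w) holomorphic_on \<D>"
    using w by (intro holomorphic_on_compose_gen[OF _ W_holomorphic])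
  moreover have "(W \<circ> w) ` \<D> \<subseteq> \<D>"
    using w(2) norm_W_less_1 by (auto simp: image_subset_iff)
  moreover have "(W \<circ> w) 0 = 0"
    by (simp add: w W_0)
  moreover have "\<forall>z\<in>\<D>. log_quot f z = G_booth \<alpha> ((W \<circ> w) z)"
  proof
    fix z assume "z \<in> \<D>"
    moreover from this w(2) have "norm (w z) < 1"
      by (auto simp: image_subset_iff)
    ultimately show "log_quot f z = G_booth \<alpha> ((W \<circ> w) z)"
      by (simp only: eq janowski_eq_booth o_apply)
  qed
  ultimately have "log_quot f \<prec>\<^sub>s G_booth \<alpha>"
    unfolding subordinate_def using hol G by blast
  with f show "f \<in> BS \<alpha>"
    by (simp add: BS_def)
qed

end

theorem theorem4p1:
  fixes \<alpha> A B :: real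
  assumes "0 \<le> \<alpha>" and "\<alpha> < 1" and "-1 < B" and "B < A" and "A \<le> 1"
    and "((1 - \<alpha>) * (1 + 6 * \<alpha> + \<alpha>^2) * \<bar>B\<bar> * (A - B) \<le> 4 * \<alpha> * (1 - B^2) \<and>
          (1 + \<alpha>)^2 * (4 * \<alpha> * (A - B)^2 + B^2) \<le> 4 * \<alpha>) \<or>
         ((1 - \<alpha>) * (1 + 6 * \<alpha> + \<alpha>^2) * \<bar>B\<bar> * (A - B) \<ge> 4 * \<alpha> * (1 - B^2) \<and>
          (1 - \<alpha>) * (A - B) + \<bar>B\<bar> \<le> 1)"
  shows "janowski_class A B \<subseteq> BS \<alpha>"
proof -
  have B: "\<bar>B\<bar> < 1" and c: "0 < A - B"
    using assms by auto
  have "B^2 + (A - B)^2 * (1 + \<alpha>)^2 - 2 * B * (A - B) * (1 - \<alpha>) * t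
      - 4 * \<alpha> * (A - B)^2 * t^2 \<le> 1" if t: "\<bar>t\<bar> \<le> 1" for t
    using assms(6)
  proof
    assume i: "(1 - \<alpha>) * (1 + 6 * \<alpha> + \<alpha>^2) * \<bar>B\<bar> * (A - B) \<le> 4 * \<alpha> * (1 - B^2) \<and>
      (1 + \<alpha>)^2 * (4 * \<alpha> * (A - B)^2 + B^2) \<le> 4 * \<alpha>"
    show ?thesis
    proof (cases "\<alpha> = 0")
      case True
      \<comment> \<open>At \<alpha> = 0 the first inequality of (i) reads |B| (A - B) \<le> 0; the
        goal then becomes A^2 \<le> 1.\<close>
      with i have "B = 0" by simp
      then show ?thesis
        using True assms by (simp add: power_le_one)
    next
      case False
      then show ?thesis
        using i assms(1) by (intro ellipse_bound_vertex) auto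
    qed
  next
    assume "(1 - \<alpha>) * (1 + 6 * \<alpha> + \<alpha>^2) * \<bar>B\<bar> * (A - B) \<ge> 4 * \<alpha> * (1 - B^2) \<and>
      (1 - \<alpha>) * (A - B) + \<bar>B\<bar> \<le> 1"
    then show ?thesis
      using assms(1,2) B c t by (intro ellipse_bound_endpoint) auto
  qed
  then interpret ellipse_in_disc \<alpha> "A - B" B
    using assms(1,2) B c by unfold_locales auto
  show ?thesis
    using janowski_class_subset_BS by simp
qed

end
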